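(* Let $k,n$ be positive integers, let $1\le i_1\le i_2\le\cdots\le i_k$ be integers and let $x_1,\ldots,x_k\in[-1,1]$. Then \[\prod_{j=1}^k\zeta_n(i_j;x_j)=\sum_{j=0}^{k-1}\ \sum_{1\le l_1<\cdots<l_j\le k}(-1)^{k-j+1}\sum_{m=1}^n\frac{\zeta_m(i_{l_1};x_{l_1})\cdots\zeta_m(i_{l_j};x_{l_j})}{m^{\,i_1+\cdots+i_k-(i_{l_1}+\cdots+i_{l_j})}}\prod_{\substack{1\le a\le k\\ a\notin\{l_1,\ldots,l_j\}}}x_a^m,\] where the term corresponding to $j=0$ is $(-1)^{k+1}\zeta_n(i_1+\cdots+i_k;\,x_1\cdots x_k)$.
   Context: For positive integers $n,m$ and $c\in\mathbb C$, $\zeta_n(m;c)=\sum_{r=1}^n c^r/r^m$. *)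

theory Defs
  imports Complex_Main
begin

definition zeta_fin :: "nat \<Rightarrow> nat \<Rightarrow> complex \<Rightarrow> complex" where
  "zeta_fin n m c = (\<Sum>r=1..n. c ^ r / of_nat r ^ m)"

end

theory Submission
  imports Defs
begin

text \<open>
  Each step \<open>P m - P (m - 1)\<close> of the product \<open>P m\<close> of partial sums is expanded by writing
  \<open>\<zeta>\<^bsub>m-1\<^esub>(i; x) = \<zeta>\<^sub>m(i; x) - x^m / m^i\<close> in every factor of \<open>P (m - 1)\<close>. The subset that selects
  \<open>\<zeta>\<^sub>m\<close> in all factors cancels \<open>P m\<close>, and the remaining ones telescope to \<open>P n\<close>.
\<close>

text \<open>Expand the second product, with \<open>L\<close> the set of factors that contribute
  \<open>f\<close>. The term \<open>L = A\<close> is \<open>prod f A\<close> and cancels; the minus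
  sign in front of the remaining terms becomes the \<open>+ 1\<close> in the exponent.\<close>

lemma prod_minus_prod_diff_eq_sum_psubsets:
  fixes f g :: "'a \<Rightarrow> 'b::comm_ring_1"
  assumes "finite A"
  shows "(\<Prod>a\<in>A. f a) - (\<Prod>a\<in>A. f a - g a) =
    (\<Sum>L | L \<subset> A. (-1) ^ (card A - card L + 1) * (prod f L * prod g (A - L)))"
proof -
  have Pow: "Pow A = insert A {L. L \<subset> A}"
    by auto
  moreover have "finite (Pow A)"
    using assms by simp
  ultimately have fin: "finite {L. L \<subset> A}"
    by simp
  have "(\<Prod>a\<in>A. f a - g a) =
      (\<Sum>L\<in>Pow A. (-1) ^ (card A - card L) * prod f L * prod g (A - L))"
    by (rule prod_diff_conv_sum'[OF assms])
  also have "\<dots> = prod f A - (\<Sum>L | L \<subset> A. (-1) ^ (card A - card L + 1) * (prod f L * prod g (A - L)))"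
    unfolding Pow using fin by (simp add: sum_negf mult.assoc)
  finally show ?thesis
    by simp
qed

text \<open>The telescoping works for arbitrary summands in a commutative ring; the theorem is the
  instance \<open>f a r = x a ^ r / r ^ i a\<close>.\<close>

lemma prod_sum_eq_sum_psubsets:
  fixes f :: "'a \<Rightarrow> nat \<Rightarrow> 'b::comm_ring_1"
  assumes "finite A" and "A \<noteq> {}"
  shows "(\<Prod>a\<in>A. \<Sum>r=1..n. f a r) =
    (\<Sum>L | L \<subset> A. (-1) ^ (card A - card L + 1) *
      (\<Sum>m=1..n. (\<Prod>l\<in>L. \<Sum>r=1..m. f l r) * (\<Prod>a\<in>A - L. f a m)))"
proof (induction n)
  case 0
  \<comment> \<open>The left side is \<open>0 ^ card A\<close>, which vanishes because
    \<open>A\<close> is nonempty; on the right every sum over \<open>m\<close> is empty.\<close>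
  show ?case
    using assms by (simp add: power_0_left)
next
  case (Suc n)
  have prev: "(\<Sum>r=1..n. f a r) = (\<Sum>r=1..Suc n. f a r) - f a (Suc n)" for a
    by simp
  have "(\<Prod>a\<in>A. \<Sum>r=1..Suc n. f a r) - (\<Prod>a\<in>A. \<Sum>r=1..n. f a r) =
    (\<Sum>L | L \<subset> A. (-1) ^ (card A - card L + 1) *
      ((\<Prod>l\<in>L. \<Sum>r=1..Suc n. f l r) * (\<Prod>a\<in>A - L. f a (Suc n))))"
    unfolding prev by (rule prod_minus_prod_diff_eq_sum_psubsets[OF assms(1)])
  then have "(\<Prod>a\<in>A. \<Sum>r=1..Suc n. f a r) =
    (\<Sum>L | L \<subset> A. (-1) ^ (card A - card L + 1) *
      ((\<Prod>l\<in>L. \<Sum>r=1..Suc n. f l r) * (\<Prod>a\<in>A - L. f a (Suc n)))) +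
    (\<Prod>a\<in>A. \<Sum>r=1..n. f a r)"
    unfolding diff_eq_eq .
  \<comment> \<open>After the induction hypothesis, both summands run over the same \<open>L\<close>
    with the same sign, so the increment is the term \<open>m = Suc n\<close> of the inner
    sum.\<close>
  also have "\<dots> = (\<Sum>L | L \<subset> A. (-1) ^ (card A - card L + 1) *
      (\<Sum>m=1..Suc n. (\<Prod>l\<in>L. \<Sum>r=1..m. f l r) * (\<Prod>a\<in>A - L. f a m)))"
    unfolding Suc.IH sum.distrib[symmetric] distrib_left[symmetric]
    by (simp add: add.commute)
  finally show ?case .
qed

lemma sum_psubsets_by_card:
  assumes "finite A" and "A \<noteq> {}"
  shows "(\<Sum>L | L \<subset> A. h L) = (\<Sum>j=0..card A - 1. \<Sum>L | L \<subseteq> A \<and> card L = j. h L)"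
proof -
  have "card A > 0"
    using assms by (simp add: card_gt_0_iff)
  \<comment> \<open>Since \<open>card A > 0\<close>, the truncated bound
    \<open>j \<le> card A - 1\<close> means \<open>j < card A\<close>, so a subset of size
    \<open>j\<close> is automatically proper.\<close>
  then have eq: "{L. L \<subset> A \<and> card L = j} = {L. L \<subseteq> A \<and> card L = j}" if "j \<in> {0..card A - 1}" for j
    using that by auto
  have fin: "finite {L. L \<subset> A}"
    using assms(1) by (auto intro: finite_subset[of _ "Pow A"])
  have "card L \<in> {0..card A - 1}" if "L \<subset> A" for L
    using psubset_card_mono[OF assms(1) that] by simp
  then have img: "card ` {L. L \<subset> A} \<subseteq> {0..card A - 1}"
    by (intro image_subsetI) (simp only: mem_Collect_eq)
  have "(\<Sum>L | L \<subset> A. h L) = (\<Sum>j=0..card A - 1. \<Sum>L | L \<subset> A \<and> card L = j. h L)"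
    using sum.group[where g = card and h = h, OF fin finite_atLeastAtMost img] by simp
  also have "\<dots> = (\<Sum>j=0..card A - 1. \<Sum>L | L \<subseteq> A \<and> card L = j. h L)"
    by (intro sum.cong refl) (simp only: eq)
  finally show ?thesis .
qed

theorem theorem3p10:
  fixes k n :: nat and i :: "nat \<Rightarrow> nat" and x :: "nat \<Rightarrow> real"
  assumes "k \<ge> 1" and "n \<ge> 1"
    and "\<forall>a\<in>{1..k}. 1 \<le> i a"
    and "\<forall>a\<in>{1..k}. \<forall>b\<in>{1..k}. a \<le> b \<longrightarrow> i a \<le> i b"
    and "\<forall>a\<in>{1..k}. x a \<in> {-1..1}"
  shows "let T = (\<lambda>j. \<Sum>L | L \<subseteq> {1..k} \<and> card L = j.
            (-1) ^ (k - j + 1) *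
            (\<Sum>m=1..n.
               (\<Prod>l\<in>L. zeta_fin m (i l) (complex_of_real (x l)))
                 / of_nat m ^ ((\<Sum>a=1..k. i a) - (\<Sum>l\<in>L. i l))
               * (\<Prod>a\<in>{1..k} - L. complex_of_real (x a) ^ m)))
         in (\<Prod>j=1..k. zeta_fin n (i j) (complex_of_real (x j))) = (\<Sum>j=0..k-1. T j)
            \<and> T 0 = (-1) ^ (k + 1)
                * zeta_fin n (\<Sum>a=1..k. i a) (complex_of_real (\<Prod>a=1..k. x a))"
proof -
  define h where "h L = (\<Sum>m=1..n.
      (\<Prod>l\<in>L. zeta_fin m (i l) (complex_of_real (x l)))
        / of_nat m ^ ((\<Sum>a=1..k. i a) - (\<Sum>l\<in>L. i l))
      * (\<Prod>a\<in>{1..k} - L. complex_of_real (x a) ^ m))" for L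
  have h: "h L = (\<Sum>m=1..n. (\<Prod>l\<in>L. \<Sum>r=1..m. complex_of_real (x l) ^ r / of_nat r ^ i l) *
      (\<Prod>a\<in>{1..k} - L. complex_of_real (x a) ^ m / of_nat m ^ i a))" if "L \<subset> {1..k}" for L
  proof -
    \<comment> \<open>The subtraction of naturals does not truncate, as \<open>L\<close> lies in
      \<open>{1..k}\<close>. The power of \<open>m\<close> then splits into one factor
      \<open>m ^ i a\<close> for each \<open>a\<close> outside \<open>L\<close>.\<close>
    have "(\<Sum>a=1..k. i a) - (\<Sum>l\<in>L. i l) = (\<Sum>a\<in>{1..k} - L. i a)"
      using that by (intro sum_diff_nat[symmetric]) (auto intro: finite_subset)
    then show ?thesis
      by (simp add: h_def zeta_fin_def prod_dividef power_sum)
  qed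
  have "(\<Prod>j=1..k. zeta_fin n (i j) (complex_of_real (x j))) =
      (\<Sum>L | L \<subset> {1..k}. (-1) ^ (k - card L + 1) * h L)"
    unfolding zeta_fin_def using assms(1)
    by (subst prod_sum_eq_sum_psubsets) (auto simp: h intro!: sum.cong)
  also have "\<dots> = (\<Sum>j=0..k-1. \<Sum>L | L \<subseteq> {1..k} \<and> card L = j. (-1) ^ (k - card L + 1) * h L)"
    using assms(1) by (subst sum_psubsets_by_card) auto
  also have "\<dots> = (\<Sum>j=0..k-1. \<Sum>L | L \<subseteq> {1..k} \<and> card L = j. (-1) ^ (k - j + 1) * h L)"
    by (intro sum.cong) auto
  finally have expansion: "(\<Prod>j=1..k. zeta_fin n (i j) (complex_of_real (x j))) = \<dots>" .
  \<comment> \<open>Infinite sets also have \<open>card\<close> 0, so finiteness of the subsets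
    enters here.\<close>
  have "{L. L \<subseteq> {1..k} \<and> card L = 0} = {{}}"
    by (auto dest: finite_subset)
  moreover have "h {} = zeta_fin n (\<Sum>a=1..k. i a) (complex_of_real (\<Prod>a=1..k. x a))"
    by (simp add: h_def zeta_fin_def prod_power_distrib)
  ultimately have "(\<Sum>L | L \<subseteq> {1..k} \<and> card L = 0. (-1) ^ (k - 0 + 1) * h L) =
      (-1) ^ (k + 1) * zeta_fin n (\<Sum>a=1..k. i a) (complex_of_real (\<Prod>a=1..k. x a))"
    by simp
  with expansion show ?thesis
    unfolding Let_def h_def by blast
qed

end
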